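(* There exists an absolute constant $c>0$ such that for all positive integers $s,n$ with $(2s+1)\mid n$, one can find an example of a connected graph $G$ of order $n$ with radius $r=s+2$ such that $$\operatorname{ept}(G)\ge c\cdot r\log\frac{n}{r}.$$
   Context: For a graph $G=(V,E)$, the order is $|V|$ and the radius is the minimum eccentricity of a vertex $v\in V$. Probabilistic zero forcing on $G$: each vertex is blue or white; blue vertices stay blue; in each discrete time step, if $B$ is the current set of blue vertices, each $u\in B$ attempts to force each of its white neighbors $v$ blue, independently, succeeding with probability $\frac{|N[u]\cap B|}{\deg u}$, where $N[u]$ is the closed neighborhood of $u$ (it includes $u$); a white vertex becomes blue if at least one attempt on it succeeds. For a nonempty $S\subseteq V$, $\operatorname{ept}(G,S)$ is the expected number of steps until all vertices are blue when exactly the vertices of $S$ are initially blue, and $\operatorname{ept}(G)=\min_{v\in V}\operatorname{ept}(G,\{v\})$.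
   Formalization: The case n = 2s+1 is excluded: a connected graph of order n has radius at most n/2, so none of order 2s+1 has radius s+2 (e.g. s = 1, n = 3); all other multiples n of 2s+1 are covered. *)

theory Defs
  imports
    "HOL-Probability.Probability"
    "HOL-Probability.Product_PMF"
    "Graph_Theory.Pair_Digraph"
    "Graph_Theory.Digraph_Component"
    "Graph_Theory.Shortest_Path"
begin

text \<open>Simple graphs are \<^locale>\<open>pair_graph\<close>s: finite, loop-free, symmetric, with an edge
  between u and v represented by the two arcs (u, v) and (v, u).  The distance between two
  vertices is the shortest-path cost for unit arc weights (infinity if there is no path).\<close>

definition eccentricity :: "'a pair_pre_digraph \<Rightarrow> 'a \<Rightarrow> ereal" where
  "eccentricity G v = (SUP u\<in>pverts G. wf_digraph.\<mu> (with_proj G) (\<lambda>_. 1) v u)"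

definition radius :: "'a pair_pre_digraph \<Rightarrow> ereal" where
  "radius G = (INF v\<in>pverts G. eccentricity G v)"

definition closed_nbhd :: "'a pair_pre_digraph \<Rightarrow> 'a \<Rightarrow> 'a set" where
  "closed_nbhd G u = insert u {v. (u, v) \<in> parcs G}"

definition force_prob :: "'a pair_pre_digraph \<Rightarrow> 'a set \<Rightarrow> 'a \<Rightarrow> real" where
  "force_prob G B u = real (card (closed_nbhd G u \<inter> B)) / real (out_degree (with_proj G) u)"

definition attempts :: "'a pair_pre_digraph \<Rightarrow> 'a set \<Rightarrow> ('a \<times> 'a) set" where
  "attempts G B = {(u, v). (u, v) \<in> parcs G \<and> u \<in> B \<and> v \<notin> B}"

text \<open>\<^const>\<open>Pi_pmf\<close> makes the attempts of one time step independent; \<^term>\<open>f (u, v)\<close> tells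
  whether the attempt of u on v succeeds.\<close>

definition pzf_step :: "'a pair_pre_digraph \<Rightarrow> 'a set \<Rightarrow> 'a set pmf" where
  "pzf_step G B =
     map_pmf (\<lambda>f. B \<union> {v. \<exists>u. (u, v) \<in> attempts G B \<and> f (u, v)})
       (Pi_pmf (attempts G B) False (\<lambda>(u, v). bernoulli_pmf (force_prob G B u)))"

text \<open>The law of the whole process (the blue set at times 0, 1, 2, ...) is the measure on
  trajectories that the Ionescu-Tulcea theorem yields from the following kernels.  The kernel
  for time i is applied to the history \<^term>\<open>X\<close>, of which only the last entry is used.\<close>

definition pzf_kernel :: "'a pair_pre_digraph \<Rightarrow> 'a set \<Rightarrow> nat \<Rightarrow> (nat \<Rightarrow> 'a set) \<Rightarrow> 'a set measure"
  where
  "pzf_kernel G S i X =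
     (case i of 0 \<Rightarrow> measure_pmf (return_pmf S) | Suc j \<Rightarrow> measure_pmf (pzf_step G (X j)))"

definition pzf_process :: "'a pair_pre_digraph \<Rightarrow> 'a set \<Rightarrow> (nat \<Rightarrow> 'a set) measure" where
  "pzf_process G S =
     projective_family.lim UNIV
       (Ionescu_Tulcea.CI (pzf_kernel G S) (\<lambda>_. count_space UNIV)) (\<lambda>_. count_space UNIV)"

lemma Ionescu_Tulcea_pzf:
  fixes G :: "'a pair_pre_digraph"
  shows "Ionescu_Tulcea (pzf_kernel G S) (\<lambda>_. count_space UNIV)"
proof (rule Ionescu_Tulcea.intro)
  fix i
  show "pzf_kernel G S i \<in> measurable (PiM {0..<i} (\<lambda>_. count_space UNIV))
    (subprob_algebra (count_space UNIV))"
  proof (cases i)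
    case 0
    then show ?thesis
      by (auto simp: pzf_kernel_def[abs_def] space_subprob_algebra
          intro!: measurable_const prob_space_imp_subprob_space prob_space_measure_pmf)
  next
    case (Suc j)
    have "(\<lambda>X. X j) \<in> measurable (PiM {0..<i} (\<lambda>_. count_space UNIV)) (count_space UNIV)"
      using Suc by (intro measurable_component_singleton) auto
    moreover have "(\<lambda>B. measure_pmf (pzf_step G B)) \<in>
        measurable (count_space UNIV) (subprob_algebra (count_space UNIV))"
      by (auto simp: space_subprob_algebra
          intro!: prob_space_imp_subprob_space prob_space_measure_pmf)
    ultimately have "(\<lambda>X. measure_pmf (pzf_step G (X j))) \<in>
        measurable (PiM {0..<i} (\<lambda>_. count_space UNIV)) (subprob_algebra (count_space UNIV))"
      by (rule measurable_compose)
    then show ?thesis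
      using Suc by (simp add: pzf_kernel_def[abs_def])
  qed
next
  fix i and X :: "nat \<Rightarrow> 'a set"
  show "prob_space (pzf_kernel G S i X)"
    by (auto simp: pzf_kernel_def prob_space_measure_pmf split: nat.split)
qed

text \<open>The infimum over the empty set, i.e. on trajectories that never reach the full vertex
  set, is \<^term>\<open>\<infinity> :: ennreal\<close>.\<close>

definition propagation_time :: "'a pair_pre_digraph \<Rightarrow> (nat \<Rightarrow> 'a set) \<Rightarrow> ennreal" where
  "propagation_time G X = (INF t\<in>{t. X t = pverts G}. of_nat t)"

definition ept_from :: "'a pair_pre_digraph \<Rightarrow> 'a set \<Rightarrow> ennreal" where
  "ept_from G S = (\<integral>\<^sup>+ X. propagation_time G X \<partial>pzf_process G S)"

definition ept :: "'a pair_pre_digraph \<Rightarrow> ennreal" where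
  "ept G = (INF v\<in>pverts G. ept_from G {v})"

end

theory Submission
  imports Defs
begin

text \<open>
  Write n = (2s+1)m.  The example is a caterpillar: a spine path with 2s+4 vertices whose 2s
  central vertices 2, ..., 2s+1 carry all remaining vertices as leaves, at least m-2 each.
  Wherever the process starts, one half of the spine is white, and the blue front has to cross
  the s vertices of degree at least m in it one after the other.  When the front sits on a
  vertex of degree d with x blue vertices in its closed neighbourhood, that number at most
  doubles in expectation in one step and the front advances with probability x/d.  Hence
  (ln (d/x) + 1)/2 loses at most 1 per step in expectation, and the sum of these terms over the
  vertices still to be crossed is a potential that bounds the expected time from below.
\<close>

section \<open>Lower bounds from potential functions\<close>

context Ionescu_Tulcea
begin

text \<open>Replaces the infinite limit by the finite composition \<open>C 0 n\<close> of kernels,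
  since the projection of the limit to the first \<open>n\<close> coordinates is
  \<open>CI {0..<n}\<close>.\<close>

lemma nn_integral_lim:
  assumes f[measurable]: "f \<in> borel_measurable (PiM {0..<n} M)"
  shows "(\<integral>\<^sup>+X. f (restrict X {0..<n}) \<partial>PF.lim) = (\<integral>\<^sup>+X. f X \<partial>C 0 n (\<lambda>_. undefined))"
proof -
  \<comment> \<open>\<open>CI J\<close> is the restriction to \<open>J\<close> of
    \<open>C 0 (up_to J)\<close>; for \<open>J = {0..<n}\<close> this makes the restriction
    trivial.\<close>
  have up: "up_to {0..<n} = n"
    by (intro antisym) (auto simp: up_to_iff, metis up_to_less finite_atLeastLessThan atLeastLessThan_iff
        le0 less_irrefl not_le)
  have [measurable]: "(\<lambda>X. restrict X {0..<n}) \<in> measurable PF.lim (PiM {0..<n} M)"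
    by (auto intro!: measurable_restrict measurable_component_singleton
        simp: measurable_cong_sets[OF PF.sets_lim refl])
  have sp: "space (C 0 n (\<lambda>_. undefined)) = space (PiM {0..<n} M)"
    using space_C[of "\<lambda>_. undefined" 0 n] by simp
  have C[measurable_cong]: "sets (C 0 n (\<lambda>_. undefined)) = sets (PiM {0..<n} M)"
    using sets_C[of "\<lambda>_. undefined" 0 n] by simp
  have "(\<integral>\<^sup>+X. f (restrict X {0..<n}) \<partial>PF.lim) = (\<integral>\<^sup>+X. f X \<partial>CI {0..<n})"
    by (subst distr_lim[symmetric]) (simp_all add: nn_integral_distr)
  also have "\<dots> = (\<integral>\<^sup>+X. f (restrict X {0..<n}) \<partial>C 0 n (\<lambda>_. undefined))"
    unfolding CI_def up
    by (subst nn_integral_distr) (auto intro!: measurable_restrict measurable_component_singleton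
        simp: measurable_cong_sets[OF C refl])
  also have "\<dots> = (\<integral>\<^sup>+X. f X \<partial>C 0 n (\<lambda>_. undefined))"
    by (intro nn_integral_cong) (auto simp: sp space_PiM PiE_restrict)
  finally show ?thesis .
qed

text \<open>Given the past, coordinate \<open>n\<close> has law \<open>P n\<close>:
  \<open>C 0 (Suc n)\<close> is \<open>C 0 n\<close> followed by one draw appended by
  \<open>eP n\<close>, and the factor \<open>f\<close> depends on the past alone, so it leaves the
  inner integral.\<close>

lemma nn_integral_lim_kernel:
  assumes f[measurable]: "f \<in> borel_measurable (PiM {0..<n} M)"
    and g[measurable]: "g \<in> borel_measurable (M n)"
  shows "(\<integral>\<^sup>+X. f (restrict X {0..<n}) * g (X n) \<partial>PF.lim) =
    (\<integral>\<^sup>+X. f (restrict X {0..<n}) * (\<integral>\<^sup>+y. g y \<partial>P n (restrict X {0..<n})) \<partial>PF.lim)"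
proof -
  have sp: "space (C 0 n (\<lambda>_. undefined)) = space (PiM {0..<n} M)"
    using space_C[of "\<lambda>_. undefined" 0 n] by simp
  have C: "sets (C 0 n (\<lambda>_. undefined)) = sets (PiM {0..<n} M)"
    using sets_C[of "\<lambda>_. undefined" 0 n] by simp
  define h where "h X = f (restrict X {0..<n}) * g (X n)" for X :: "nat \<Rightarrow> 'a"
  have [measurable]: "(\<lambda>X. restrict X {0..<n}) \<in> measurable (PiM {0..<Suc n} M) (PiM {0..<n} M)"
    by (auto intro!: measurable_restrict measurable_component_singleton)
  have [measurable]: "(\<lambda>X. X n) \<in> measurable (PiM {0..<Suc n} M) (M n)"
    by (auto intro!: measurable_component_singleton)
  have h: "h \<in> borel_measurable (PiM {0..<Suc n} M)"
    unfolding h_def[abs_def] by measurable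
  have "(\<integral>\<^sup>+X. f (restrict X {0..<n}) * g (X n) \<partial>PF.lim) =
      (\<integral>\<^sup>+X. h (restrict X {0..<Suc n}) \<partial>PF.lim)"
    by (intro nn_integral_cong) (simp add: h_def Int_absorb1 Int_absorb2 subset_eq)
  also have "\<dots> = (\<integral>\<^sup>+X. h X \<partial>C 0 (Suc n) (\<lambda>_. undefined))"
    by (rule nn_integral_lim[OF h])
  also have "\<dots> = (\<integral>\<^sup>+X. (\<integral>\<^sup>+Y. h Y \<partial>eP n X) \<partial>C 0 n (\<lambda>_. undefined))"
    using h by (simp add: nn_integral_bind[where B="PiM {0..<Suc n} M"] measurable_cong_sets[OF C refl])
  also have "\<dots> = (\<integral>\<^sup>+X. f X * (\<integral>\<^sup>+y. g y \<partial>P n X) \<partial>C 0 n (\<lambda>_. undefined))"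
  proof (intro nn_integral_cong)
    fix X assume "X \<in> space (C 0 n (\<lambda>_. undefined))"
    then have X: "X \<in> space (PiM {0..<n} M)" by (simp add: sp)
    then have "restrict (X(n := y)) {0..<n} = X" for y
      by (auto simp: space_PiM PiE_iff extensional_def restrict_def fun_eq_iff)
    then have "(\<integral>\<^sup>+Y. h Y \<partial>eP n X) = (\<integral>\<^sup>+y. f X * g y \<partial>P n X)"
      using X h by (simp add: nn_integral_eP h_def)
    also have "\<dots> = f X * (\<integral>\<^sup>+y. g y \<partial>P n X)"
      using X by (intro nn_integral_cmult) (simp add: measurable_cong_sets[OF sets_P refl])
    finally show "(\<integral>\<^sup>+Y. h Y \<partial>eP n X) = f X * (\<integral>\<^sup>+y. g y \<partial>P n X)" .
  qed
  also have "\<dots> = (\<integral>\<^sup>+X. f (restrict X {0..<n}) * (\<integral>\<^sup>+y. g y \<partial>P n (restrict X {0..<n})) \<partial>PF.lim)"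
    by (rule nn_integral_lim[symmetric]) measurable
  finally show ?thesis .
qed

end

section \<open>The forcing process as a Markov chain, and its drift bound\<close>

lemma sets_pzf_process: "sets (pzf_process G S) = sets (PiM UNIV (\<lambda>_. count_space UNIV))"
proof -
  interpret Ionescu_Tulcea "pzf_kernel G S" "\<lambda>_. count_space UNIV" by (rule Ionescu_Tulcea_pzf)
  show ?thesis by (simp add: pzf_process_def)
qed

lemma measurable_pzf_process_component [measurable]:
  "(\<lambda>X. X t) \<in> measurable (pzf_process G S) (count_space UNIV)"
  by (simp add: measurable_cong_sets[OF sets_pzf_process refl] measurable_component_singleton)

lemma nn_integral_pzf_process_0:
  "(\<integral>\<^sup>+X. g (X 0) \<partial>pzf_process G S) = g S"
proof -
  interpret Ionescu_Tulcea "pzf_kernel G S" "\<lambda>_. count_space UNIV" by (rule Ionescu_Tulcea_pzf)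
  have "emeasure PF.lim (space (PiM UNIV (\<lambda>_. count_space UNIV))) = 1"
    using nn_integral_lim[of "\<lambda>_. 1" 0] prob_space_C[of "\<lambda>_. undefined" 0 0]
    by (simp add: prob_space.emeasure_space_1 del: C.simps space_PiM)
  then show ?thesis
    using nn_integral_lim_kernel[of "\<lambda>_. 1" 0 g]
    by (simp add: pzf_process_def pzf_kernel_def del: space_PiM)
qed

text \<open>The Markov property in integrated form; it holds because the kernel reads only the last
  entry of the history.\<close>

lemma nn_integral_pzf_process_Suc:
  "(\<integral>\<^sup>+X. f (X t) * g (X (Suc t)) \<partial>pzf_process G S) =
   (\<integral>\<^sup>+X. f (X t) * (\<integral>\<^sup>+B. g B \<partial>pzf_step G (X t)) \<partial>pzf_process G S)"
proof -
  interpret Ionescu_Tulcea "pzf_kernel G S" "\<lambda>_. count_space UNIV" by (rule Ionescu_Tulcea_pzf)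
  have "(\<lambda>X. f (X t)) \<in> borel_measurable (PiM {0..<Suc t} (\<lambda>_. count_space UNIV))"
    by (rule measurable_compose[OF measurable_component_singleton]) auto
  from nn_integral_lim_kernel[OF this, of g] show ?thesis
    by (simp add: pzf_process_def pzf_kernel_def)
qed

lemma prob_space_pzf_process: "prob_space (pzf_process G S)"
proof
  show "emeasure (pzf_process G S) (space (pzf_process G S)) = 1"
    using nn_integral_pzf_process_0[of G S "\<lambda>_. 1"] by simp
qed

lemma pzf_step_all_blue:
  assumes "pair_wf_digraph G"
  shows "pzf_step G (pverts G) = return_pmf (pverts G)"
proof -
  have "attempts G (pverts G) = {}"
    using assms by (auto simp: attempts_def pair_wf_digraph_def)
  then show ?thesis by (simp add: pzf_step_def)
qed

text \<open>The measure lives on arbitrary sequences of sets, so absorption holds only almost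
  surely: the expected indicator of leaving the full set at a given step is 0, and there are
  countably many steps.\<close>

lemma AE_all_blue_absorbing:
  assumes "pair_wf_digraph G"
  shows "AE X in pzf_process G S. \<forall>t. X t = pverts G \<longrightarrow> X (Suc t) = pverts G"
proof (subst AE_all_countable, intro allI)
  fix t
  let ?f = "indicator {pverts G} :: _ \<Rightarrow> ennreal" and ?g = "indicator (- {pverts G}) :: _ \<Rightarrow> ennreal"
  have "(\<integral>\<^sup>+X. ?f (X t) * ?g (X (Suc t)) \<partial>pzf_process G S) =
      (\<integral>\<^sup>+X. ?f (X t) * (\<integral>\<^sup>+B. ?g B \<partial>pzf_step G (X t)) \<partial>pzf_process G S)"
    by (rule nn_integral_pzf_process_Suc)
  also have "\<dots> = (\<integral>\<^sup>+X. 0 \<partial>pzf_process G S)"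
    by (intro nn_integral_cong) (auto simp: indicator_def pzf_step_all_blue[OF assms])
  finally have "AE X in pzf_process G S. ?f (X t) * ?g (X (Suc t)) = 0"
    unfolding nn_integral_const mult_zero_left
    by (subst (asm) nn_integral_0_iff_AE)
       (auto intro!: borel_measurable_times_ennreal measurable_compose[OF measurable_pzf_process_component[of _ G S]])
  then show "AE X in pzf_process G S. X t = pverts G \<longrightarrow> X (Suc t) = pverts G"
    by eventually_elim (auto simp: indicator_def split: if_splits)
qed

text \<open>Absorption puts every unfinished time before any hitting time \<open>T\<close>, so at
  most \<open>T\<close> summands are nonzero.\<close>

lemma propagation_time_ge_suminf:
  assumes "\<forall>t. X t = pverts G \<longrightarrow> X (Suc t) = pverts G"
  shows "(\<Sum>t. indicator {X. X t \<noteq> pverts G} X) \<le> propagation_time G X"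
  unfolding propagation_time_def
proof (intro INF_greatest)
  fix T assume "T \<in> {t. X t = pverts G}"
  then have "X (T + k) = pverts G" for k
    using assms by (induction k) auto
  then have "X t = pverts G" if "t \<ge> T" for t
    using that le_Suc_ex by blast
  then have "(\<Sum>t. indicator {X. X t \<noteq> pverts G} X :: ennreal) =
      (\<Sum>t<T. indicator {X. X t \<noteq> pverts G} X)"
    by (intro suminf_finite) (auto simp: indicator_def)
  also have "\<dots> \<le> (\<Sum>t<T. 1)"
    by (intro sum_mono) (auto simp: indicator_def)
  finally show "(\<Sum>t. indicator {X. X t \<noteq> pverts G} X) \<le> (of_nat T :: ennreal)" by simp
qed

text \<open>Summing the drift bound over \<open>n\<close> steps leaves the expected potential at
  time \<open>n\<close> as a remainder. Since \<open>\<Phi>\<close> is at most \<open>M\<close> and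
  vanishes at the full set, the remainder is at most \<open>M\<close> times the probability
  \<open>w n\<close> of being unfinished, while the sum of all \<open>w t\<close> is at most the
  expected time.\<close>

lemma ept_from_ge_potential:
  fixes \<Phi> :: "'a set \<Rightarrow> ennreal"
  assumes G: "pair_wf_digraph G"
    and M: "M < \<infinity>" "\<And>B. \<Phi> B \<le> M * indicator (- {pverts G}) B"
    and drift: "\<And>B. B \<noteq> pverts G \<Longrightarrow> \<Phi> B \<le> 1 + (\<integral>\<^sup>+B'. \<Phi> B' \<partial>pzf_step G B)"
  shows "\<Phi> S \<le> ept_from G S"
proof -
  let ?L = "pzf_process G S"
  define w where "w t = (\<integral>\<^sup>+X. indicator (- {pverts G}) (X t) \<partial>?L)" for t
  have "\<Phi> S \<le> (\<Sum>t<n. w t) + (\<integral>\<^sup>+X. \<Phi> (X n) \<partial>?L)" for n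
  proof (induction n)
    case 0
    then show ?case by (simp add: nn_integral_pzf_process_0)
  next
    case (Suc n)
    have "(\<integral>\<^sup>+X. \<Phi> (X n) \<partial>?L) \<le>
        (\<integral>\<^sup>+X. indicator (- {pverts G}) (X n) + (\<integral>\<^sup>+B'. \<Phi> B' \<partial>pzf_step G (X n)) \<partial>?L)"
      using drift M(2)[of "pverts G"] by (intro nn_integral_mono) (auto simp: indicator_def)
    also have "\<dots> = w n + (\<integral>\<^sup>+X. (\<integral>\<^sup>+B'. \<Phi> B' \<partial>pzf_step G (X n)) \<partial>?L)"
      unfolding w_def
      by (intro nn_integral_add)
         (auto intro!: measurable_compose[OF measurable_pzf_process_component[of n G S]])
    also have "(\<integral>\<^sup>+X. (\<integral>\<^sup>+B'. \<Phi> B' \<partial>pzf_step G (X n)) \<partial>?L) = (\<integral>\<^sup>+X. \<Phi> (X (Suc n)) \<partial>?L)"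
      using nn_integral_pzf_process_Suc[of G S "\<lambda>_. 1" n \<Phi>] by simp
    finally have "(\<Sum>t<n. w t) + (\<integral>\<^sup>+X. \<Phi> (X n) \<partial>?L) \<le>
        (\<Sum>t<n. w t) + (w n + (\<integral>\<^sup>+X. \<Phi> (X (Suc n)) \<partial>?L))"
      by (rule add_left_mono)
    with Suc.IH show ?case
      by (simp only: sum.lessThan_Suc add.assoc)
  qed
  moreover have "(\<integral>\<^sup>+X. \<Phi> (X n) \<partial>?L) \<le> M * w n" for n
    unfolding w_def
    by (subst nn_integral_cmult[symmetric])
       (auto intro!: nn_integral_mono M measurable_compose[OF measurable_pzf_process_component[of n G S]])
  ultimately have bound: "\<Phi> S \<le> (\<Sum>t<n. w t) + M * w n" for n
    by (meson add_left_mono order_trans)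
  have "\<Phi> S \<le> (\<Sum>t. w t)"
  \<comment> \<open>An infinite sum leaves nothing to prove; a finite one forces \<open>w\<close> to
    tend to 0, which removes the remainder.\<close>
  proof (cases "(\<Sum>t. w t) = \<infinity>")
    case False
    have "(\<lambda>n. \<Sum>t<n. w t) \<longlonglongrightarrow> (\<Sum>t. w t)"
      by (intro summable_LIMSEQ) simp
    moreover have "w \<longlonglongrightarrow> 0"
    proof -
      obtain f where f: "\<And>t. w t = ennreal (f t)" "\<And>t. f t \<ge> 0" "summable f"
      proof (rule that[of "\<lambda>t. enn2real (w t)"])
        show w: "w t = ennreal (enn2real (w t))" for t
        proof -
          have "w t \<le> (\<integral>\<^sup>+X. 1 \<partial>?L)"
            unfolding w_def by (intro nn_integral_mono) (auto simp: indicator_def)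
          also have "\<dots> = 1"
            using prob_space.emeasure_space_1[OF prob_space_pzf_process[of G S]] by simp
          finally show ?thesis
            by (metis ennreal_enn2real_if ennreal_one_neq_top neq_top_trans)
        qed
        have "(\<Sum>t. ennreal (enn2real (w t))) \<noteq> top"
          using False by (simp add: w[symmetric])
        then show "summable (\<lambda>t. enn2real (w t))"
          by (intro summable_suminf_not_top) auto
      qed auto
      then show ?thesis
        using tendsto_ennrealI[OF summable_LIMSEQ_zero[OF f(3)]] by (simp flip: f(1))
    qed
    then have "(\<lambda>n. M * w n) \<longlonglongrightarrow> M * 0"
      using M(1) by (intro ennreal_tendsto_cmult) auto
    ultimately have "(\<lambda>n. (\<Sum>t<n. w t) + M * w n) \<longlonglongrightarrow> (\<Sum>t. w t) + M * 0"
      by (rule tendsto_add)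
    then show ?thesis
      using bound by (intro LIMSEQ_le_const) auto
  qed auto
  also have "\<dots> = (\<integral>\<^sup>+X. (\<Sum>t. indicator {X. X t \<noteq> pverts G} X) \<partial>?L)"
    unfolding w_def by (subst nn_integral_suminf[symmetric]) (auto intro!: measurable_compose[OF measurable_pzf_process_component[of _ G S]] nn_integral_cong suminf_cong simp: indicator_def)
  also have "\<dots> \<le> ept_from G S"
    unfolding ept_from_def
    using AE_all_blue_absorbing[OF G, of S]
    by (intro nn_integral_mono_AE) (auto elim!: eventually_mono intro: propagation_time_ge_suminf)
  finally show ?thesis .
qed

section \<open>A single forcing step\<close>

lemma finite_attempts: "finite (parcs G) \<Longrightarrow> finite (attempts G B)"
  by (rule finite_subset[of _ "parcs G"]) (auto simp: attempts_def)

lemma finite_set_pzf_step: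
  assumes "finite (parcs G)"
  shows "finite (set_pmf (pzf_step G B))"
proof -
  let ?p = "\<lambda>(u, v). bernoulli_pmf (force_prob G B u)"
  have "set_pmf (Pi_pmf (attempts G B) False ?p) \<subseteq>
      PiE_dflt (attempts G B) False (set_pmf \<circ> ?p)"
    by (rule set_Pi_pmf_subset') (rule finite_attempts[OF assms])
  moreover have "finite (PiE_dflt (attempts G B) False (set_pmf \<circ> ?p))"
    by (rule finite_PiE_dflt) (simp_all add: finite_attempts[OF assms])
  ultimately show ?thesis
    unfolding pzf_step_def set_map_pmf by (intro finite_imageI) (rule finite_subset)
qed

lemma pzf_step_superset: "B' \<in> set_pmf (pzf_step G B) \<Longrightarrow> B \<subseteq> B'"
  by (auto simp: pzf_step_def)

lemma pzf_step_new_blue: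
  assumes "B' \<in> set_pmf (pzf_step G B)" "w \<in> B'" "w \<notin> B"
  obtains u where "(u, w) \<in> parcs G" "u \<in> B"
  using assms by (auto simp: pzf_step_def attempts_def)

text \<open>As \<open>u\<close> is the only blue neighbour of \<open>w\<close>, only the attempt
  \<open>(u, w)\<close> can turn \<open>w\<close> blue, and its marginal in the product is a
  Bernoulli law.\<close>

lemma prob_pzf_step_le_force_prob:
  assumes fin: "finite (parcs G)"
    and p: "0 \<le> force_prob G B u" "force_prob G B u \<le> 1"
    and w: "(u, w) \<in> parcs G" "u \<in> B" "w \<notin> B"
    and unique: "\<And>u'. (u', w) \<in> parcs G \<Longrightarrow> u' \<in> B \<Longrightarrow> u' = u"
  shows "measure_pmf.prob (pzf_step G B) {B'. w \<in> B'} \<le> force_prob G B u"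
proof -
  let ?P = "Pi_pmf (attempts G B) False (\<lambda>(u, v). bernoulli_pmf (force_prob G B u))"
  have att: "(u, w) \<in> attempts G B" using w by (simp add: attempts_def)
  have "measure_pmf.prob (pzf_step G B) {B'. w \<in> B'} = measure_pmf.prob ?P
      ((\<lambda>f. B \<union> {v. \<exists>u. (u, v) \<in> attempts G B \<and> f (u, v)}) -` {B'. w \<in> B'})"
    unfolding pzf_step_def by (rule measure_map_pmf)
  also have "\<dots> \<le> measure_pmf.prob ?P ((\<lambda>f. f (u, w)) -` {True})"
  proof (rule measure_pmf.finite_measure_mono)
    show "(\<lambda>f. B \<union> {v. \<exists>u. (u, v) \<in> attempts G B \<and> f (u, v)}) -` {B'. w \<in> B'} \<subseteq>
        (\<lambda>f. f (u, w)) -` {True}"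
    proof
      fix f assume "f \<in> (\<lambda>f. B \<union> {v. \<exists>u. (u, v) \<in> attempts G B \<and> f (u, v)}) -` {B'. w \<in> B'}"
      then obtain u' where "(u', w) \<in> attempts G B" "f (u', w)"
        using w(3) by auto
      moreover from this(1) have "u' = u" by (intro unique) (auto simp: attempts_def)
      ultimately show "f \<in> (\<lambda>f. f (u, w)) -` {True}" by simp
    qed
  qed simp
  also have "\<dots> = measure_pmf.prob (map_pmf (\<lambda>f. f (u, w)) ?P) {True}"
    by (rule measure_map_pmf[symmetric])
  also have "map_pmf (\<lambda>f. f (u, w)) ?P = bernoulli_pmf (force_prob G B u)"
    using att by (simp add: Pi_pmf_component finite_attempts[OF fin])
  also have "measure_pmf.prob (bernoulli_pmf (force_prob G B u)) {True} = force_prob G B u"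
    using p by (simp add: measure_pmf_single)
  finally show ?thesis .
qed

lemma out_degree_eq_card: "out_degree (with_proj G) u = card {w. (u, w) \<in> parcs G}"
proof -
  have "out_arcs (with_proj G) u = Pair u ` {w. (u, w) \<in> parcs G}"
    by (auto simp: out_arcs_def)
  then show ?thesis by (simp add: out_degree_def card_image inj_on_def)
qed

section \<open>Crossing an arm\<close>

text \<open>All edges that meet the region \<^term>\<open>A\<close> join a vertex to its parent, so colour can
  enter \<^term>\<open>A\<close> and travel along \<^term>\<open>v 0\<close>, \<^term>\<open>v 1\<close>, ... only from parent to child.\<close>

locale pzf_arm = pair_graph G for G :: "'a pair_pre_digraph" +
  fixes A :: "'a set" and pa :: "'a \<Rightarrow> 'a" and v :: "nat \<Rightarrow> 'a" and L :: nat
  assumes arm_nbr: "\<And>x y. x \<in> A \<Longrightarrow> (x, y) \<in> parcs G \<Longrightarrow> y = pa x \<or> y \<in> A \<and> pa y = x"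
    and v_in_A: "\<And>i. i \<le> L \<Longrightarrow> v i \<in> A"
    and pa_v: "\<And>i. i < L \<Longrightarrow> pa (v (Suc i)) = v i"
    and pa_arc: "\<And>i. i \<le> L \<Longrightarrow> (v i, pa (v i)) \<in> parcs G"
    and pa_neq: "\<And>i. i < L \<Longrightarrow> pa (v i) \<noteq> v (Suc i)"
begin

lemma sym_arc: "(x, y) \<in> parcs G \<Longrightarrow> (y, x) \<in> parcs G"
  using graph_symmetric by blast

text \<open>The invariant behind one-way travel: it holds vacuously for sets disjoint from
  \<open>A\<close>, and it makes the blue vertices among \<open>v 0\<close>, ..., \<open>v L\<close>
  an initial segment.\<close>

definition rooted :: "'a set \<Rightarrow> bool" where
  "rooted B \<longleftrightarrow> (\<forall>x\<in>A \<inter> B. pa x \<in> B)"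

text \<open>A newly blue \<open>x\<close> has a blue neighbour, which cannot be a child because
  rootedness would make \<open>x\<close> blue already. That the parent lies in \<open>B\<close>, not
  merely in \<open>B'\<close>, matters: a vertex that has just turned blue has no blue
  child.\<close>

lemma pa_blue_before:
  assumes "rooted B" "B' \<in> set_pmf (pzf_step G B)" "x \<in> A" "x \<in> B'"
  shows "pa x \<in> B"
proof (cases "x \<in> B")
  case True
  then show ?thesis using assms by (auto simp: rooted_def)
next
  case False
  with assms(2,4) obtain u where u: "(u, x) \<in> parcs G" "u \<in> B"
    by (rule pzf_step_new_blue)
  from arm_nbr[OF assms(3) sym_arc[OF u(1)]] show ?thesis
    using u False assms(1) by (auto simp: rooted_def)
qed

lemma rooted_step: "rooted B \<Longrightarrow> B' \<in> set_pmf (pzf_step G B) \<Longrightarrow> rooted B'"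
  using pa_blue_before pzf_step_superset unfolding rooted_def by blast

lemma rooted_v_down:
  assumes "rooted B" "j \<le> L" "v j \<in> B" "i \<le> j"
  shows "v i \<in> B"
  using \<open>i \<le> j\<close>
proof (induction i rule: inc_induct)
  case (step k)
  then have "v (Suc k) \<in> A \<inter> B" "pa (v (Suc k)) = v k"
    using assms(2) v_in_A pa_v by auto
  with assms(1) show ?case by (metis rooted_def)
qed (fact assms)

definition deg :: "nat \<Rightarrow> real" where
  "deg i = real (out_degree (with_proj G) (v i))"

definition blue_nbrs :: "nat \<Rightarrow> 'a set \<Rightarrow> real" where
  "blue_nbrs i B = real (card (closed_nbhd G (v i) \<inter> B))"

text \<open>The potential of the front vertex \<^term>\<open>v i\<close>.  The last branch is the value that the
  second one takes right after \<^term>\<open>v i\<close> turns blue, when exactly its parent and itself are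
  blue.\<close>

definition stage :: "nat \<Rightarrow> 'a set \<Rightarrow> real" where
  "stage i B = (if v (Suc i) \<in> B then 0
     else if v i \<in> B then ln (deg i) - ln (blue_nbrs i B) + 1
     else ln (deg i / 2) + 1)"

lemma finite_nbhd: "finite {w. (u, w) \<in> parcs G}"
  by (rule finite_subset[OF _ pair_finite_verts]) (auto dest: in_arcsD2)

lemma card_closed_nbhd: "real (card (closed_nbhd G (v i))) = deg i + 1"
proof -
  have "(v i, v i) \<notin> parcs G" using pair_no_loops by force
  then show ?thesis
    using finite_nbhd by (simp add: closed_nbhd_def deg_def out_degree_eq_card)
qed

lemma arc_v_Suc: "i < L \<Longrightarrow> (v i, v (Suc i)) \<in> parcs G"
  using pa_arc[of "Suc i"] pa_v[of i] sym_arc by auto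

lemma deg_ge_2:
  assumes "i < L"
  shows "deg i \<ge> 2"
proof -
  have "card {pa (v i), v (Suc i)} \<le> card {w. (v i, w) \<in> parcs G}"
    using assms arc_v_Suc pa_arc finite_nbhd by (intro card_mono) auto
  then show ?thesis
    using pa_neq[OF assms] by (simp add: deg_def out_degree_eq_card)
qed

lemma blue_nbrs_ge_1:
  assumes "v i \<in> B"
  shows "blue_nbrs i B \<ge> 1"
proof -
  have "card {v i} \<le> card (closed_nbhd G (v i) \<inter> B)"
    using assms finite_nbhd by (intro card_mono) (auto simp: closed_nbhd_def)
  then show ?thesis by (simp add: blue_nbrs_def)
qed

text \<open>The closed neighbourhood has \<open>deg i + 1\<close> members, one of them the white
  \<open>v (Suc i)\<close>. Hence the forcing ratio is a genuine probability and the logarithmic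
  part of \<open>stage\<close> is nonnegative.\<close>

lemma blue_nbrs_le_deg:
  assumes "i < L" "v (Suc i) \<notin> B"
  shows "blue_nbrs i B \<le> deg i"
proof -
  have "card (closed_nbhd G (v i) \<inter> B) < card (closed_nbhd G (v i))"
    using assms arc_v_Suc finite_nbhd by (intro psubset_card_mono) (auto simp: closed_nbhd_def)
  then show ?thesis
    using card_closed_nbhd[of i] by (simp add: blue_nbrs_def)
qed

lemma stage_nonneg:
  assumes "i < L"
  shows "stage i B \<ge> 0"
  using assms deg_ge_2[of i] blue_nbrs_le_deg[of i B] blue_nbrs_ge_1[of i B]
  by (auto simp: stage_def)

lemma stage_le:
  assumes "i < L"
  shows "stage i B \<le> ln (deg i) + 1"
  using assms deg_ge_2[of i] blue_nbrs_ge_1[of i B]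
  by (auto simp: stage_def ln_div)

text \<open>The critical case is that \<open>v i\<close> turns blue in this very step. No child of
  it can be blue yet, so its closed neighbourhood holds exactly two blue vertices, and the two
  formulas in \<open>stage\<close> agree.\<close>

lemma stage_drift_inactive:
  assumes B: "rooted B" "B' \<in> set_pmf (pzf_step G B)" and i: "i < L"
    and inactive: "v i \<in> B \<Longrightarrow> v (Suc i) \<in> B"
  shows "stage i B' = stage i B"
proof (cases "v i \<in> B")
  case True
  then show ?thesis
    using inactive pzf_step_superset[OF B(2)] by (auto simp: stage_def)
next
  case False
  have no_child: "y \<notin> B'" if "y \<in> A" "pa y = v i" for y
    using pa_blue_before[OF B, of y] False that by auto
  have Suc: "v (Suc i) \<notin> B'" "v (Suc i) \<notin> B"
    using no_child[of "v (Suc i)"] pzf_step_superset[OF B(2)] i v_in_A pa_v by auto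
  show ?thesis
  proof (cases "v i \<in> B'")
    case True
    then have pa: "pa (v i) \<in> B'"
      using pa_blue_before[OF B, of "v i"] pzf_step_superset[OF B(2)] i v_in_A by auto
    have "closed_nbhd G (v i) \<inter> B' = {v i, pa (v i)}"
      using True pa pa_arc[of i] i no_child arm_nbr[OF v_in_A[of i]]
      by (auto simp: closed_nbhd_def)
    moreover have "v i \<noteq> pa (v i)"
      using pa_arc[of i] i pair_no_loops by fastforce
    ultimately have "blue_nbrs i B' = 2" by (simp add: blue_nbrs_def)
    then show ?thesis
      using True False Suc deg_ge_2[OF i] by (simp add: stage_def ln_div)
  next
    case False
    then show ?thesis using \<open>v i \<notin> B\<close> Suc by (simp add: stage_def)
  qed
qed

text \<open>Two losses of at most 1 each give the 2. With \<open>x\<close> blue vertices and degree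
  \<open>d\<close>, the \<open>d + 1 - x\<close> white neighbours each turn blue with probability at
  most \<open>x / d\<close>, so the logarithm grows by at most \<open>(d + 1 - x) / d\<close> in
  expectation. With probability at most \<open>x / d\<close> the front advances and at most
  \<open>T = ln (d / x) + 1\<close> is lost, where \<open>T\<close> is at most
  \<open>d / x\<close>.\<close>

lemma stage_drift_active:
  assumes B: "rooted B" and i: "i < L" and act: "v i \<in> B" "v (Suc i) \<notin> B"
  shows "stage i B \<le> 2 + measure_pmf.expectation (pzf_step G B) (stage i)"
proof -
  define x where "x = blue_nbrs i B"
  define d where "d = deg i"
  define T where "T = ln d - ln x + 1"
  define W where "W = {w. (v i, w) \<in> parcs G} - B"
  let ?P = "\<lambda>w. measure_pmf.prob (pzf_step G B) {B'. w \<in> B'}"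
  have x1: "1 \<le> x" using blue_nbrs_ge_1[OF act(1)] by (simp add: x_def)
  have xd: "x \<le> d" using blue_nbrs_le_deg[OF i act(2)] by (simp add: x_def d_def)
  have finW: "finite W" using finite_nbhd by (simp add: W_def)
  have SucW: "v (Suc i) \<in> W" using arc_v_Suc[OF i] act by (simp add: W_def)
  have fin: "finite (set_pmf (pzf_step G B))" by (rule finite_set_pzf_step[OF pair_finite_arcs])
  have int: "integrable (measure_pmf (pzf_step G B)) f" for f :: "'a set \<Rightarrow> real"
    by (rule integrable_measure_pmf_finite[OF fin])
  have fp: "force_prob G B (v i) = x / d"
    by (simp add: force_prob_def x_def d_def blue_nbrs_def deg_def)
  \<comment> \<open>A white neighbour \<open>w\<close> is not the parent of \<open>v i\<close>,
    which is blue, hence a child; its own children are white by rootedness, so \<open>v i\<close> is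
    its only blue neighbour.\<close>
  have Pw: "?P w \<le> x / d" if "w \<in> W" for w
  proof -
    have w: "(v i, w) \<in> parcs G" "w \<notin> B" using that by (auto simp: W_def)
    then have "w \<noteq> pa (v i)" using B act i v_in_A[of i] by (auto simp: rooted_def)
    then have wA: "w \<in> A" "pa w = v i"
      using arm_nbr[OF v_in_A[of i] w(1)] i by auto
    have unique: "u = v i" if "(u, w) \<in> parcs G" "u \<in> B" for u
      using arm_nbr[OF wA(1) sym_arc[OF that(1)]] wA w that B by (auto simp: rooted_def)
    have "?P w \<le> force_prob G B (v i)"
      by (rule prob_pzf_step_le_force_prob[OF pair_finite_arcs _ _ w(1) act(1) w(2) unique])
         (use x1 xd in \<open>auto simp: fp\<close>)
    then show ?thesis by (simp add: fp)
  qed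
  have finC: "finite (closed_nbhd G (v i))" using finite_nbhd by (simp add: closed_nbhd_def)
  have "closed_nbhd G (v i) - B = W"
    using act by (auto simp: closed_nbhd_def W_def)
  then have "card (closed_nbhd G (v i)) = card (closed_nbhd G (v i) \<inter> B) + card W"
    using card_Int_Diff[OF finC, of B] by simp
  then have cardW: "real (card W) = d + 1 - x"
    using card_closed_nbhd[of i] by (simp add: d_def x_def blue_nbrs_def)
  define \<sigma> :: "'a set \<Rightarrow> real" where "\<sigma> B' = (\<Sum>w\<in>W. indicator {B'. w \<in> B'} B')" for B'
  have \<sigma>_nonneg: "\<sigma> B' \<ge> 0" for B' unfolding \<sigma>_def by (intro sum_nonneg) auto
  \<comment> \<open>Linearising the logarithm leaves only single-vertex probabilities to bound. If
    \<open>v (Suc i)\<close> turns blue, the two \<open>T\<close> terms cancel and the stage is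
    0.\<close>
  have pointwise: "T - \<sigma> B' / x - T * indicator {B'. v (Suc i) \<in> B'} B'
      \<le> stage i B'" if "B' \<in> set_pmf (pzf_step G B)" for B'
  proof (cases "v (Suc i) \<in> B'")
    case True
    then show ?thesis using x1 \<sigma>_nonneg[of B'] by (simp add: stage_def)
  next
    case False
    note sup = pzf_step_superset[OF that]
    have "closed_nbhd G (v i) \<inter> B' = (closed_nbhd G (v i) \<inter> B) \<union> (W \<inter> B')"
      using sup act by (auto simp: closed_nbhd_def W_def)
    moreover have "card ((closed_nbhd G (v i) \<inter> B) \<union> (W \<inter> B')) =
        card (closed_nbhd G (v i) \<inter> B) + card (W \<inter> B')"
      using finW finC by (intro card_Un_disjoint) (auto simp: W_def)
    moreover have "\<sigma> B' = real (card (W \<inter> B'))"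
      using finW by (simp add: \<sigma>_def indicator_def sum.If_cases Int_def)
    ultimately have N: "blue_nbrs i B' = x + \<sigma> B'"
      by (simp add: blue_nbrs_def x_def)
    have "x + \<sigma> B' = x * (1 + \<sigma> B' / x)" using x1 by (simp add: distrib_left)
    moreover have "0 < 1 + \<sigma> B' / x" using x1 \<sigma>_nonneg by (intro add_pos_nonneg) auto
    ultimately have "ln (x + \<sigma> B') - ln x = ln (1 + \<sigma> B' / x)"
      using x1 by (simp add: ln_mult_pos)
    also have "\<dots> \<le> \<sigma> B' / x"
      using x1 \<sigma>_nonneg by (intro ln_add_one_self_le_self) simp
    finally show ?thesis
      using False act sup by (auto simp: stage_def N T_def d_def)
  qed
  have "T - 2 \<le> T - (\<Sum>w\<in>W. x / d) / x - T * (x / d)"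
  proof -
    have "(\<Sum>w\<in>W. x / d) / x = (d + 1 - x) / d"
      using x1 by (simp add: cardW)
    also have "\<dots> \<le> 1" using x1 xd by simp
    finally have 1: "(\<Sum>w\<in>W. x / d) / x \<le> 1" .
    have "T \<le> d / x"
      using ln_le_minus_one[of "d / x"] x1 xd by (simp add: T_def ln_div)
    then have "T * (x / d) \<le> (d / x) * (x / d)"
      using x1 xd by (intro mult_right_mono) auto
    then have "T * (x / d) \<le> 1" using x1 xd by simp
    with 1 show ?thesis by simp
  qed
  also have "\<dots> \<le> T - (\<Sum>w\<in>W. ?P w) / x - T * ?P (v (Suc i))"
    using Pw SucW x1 xd
    by (intro diff_mono order_refl divide_right_mono sum_mono mult_left_mono) (auto simp: T_def)
  also have "\<dots> = measure_pmf.expectation (pzf_step G B)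
      (\<lambda>B'. T - \<sigma> B' / x - T * indicator {B'. v (Suc i) \<in> B'} B')"
    by (simp add: int \<sigma>_def)
  also have "\<dots> \<le> measure_pmf.expectation (pzf_step G B) (stage i)"
    using pointwise by (intro integral_mono_AE int) (auto simp: AE_measure_pmf_iff)
  finally show ?thesis
    using act by (simp add: stage_def T_def d_def x_def)
qed

text \<open>At most one stage is active at a time, so the sum of the stages falls by at most 2 per
  step in expectation; halving it gives a valid potential. The left side is its value when all
  \<open>v i\<close> are white.\<close>

lemma ept_from_ge_arm:
  assumes "S \<inter> A = {}"
  shows "ennreal ((\<Sum>i<L. ln (deg i / 2) + 1) / 2) \<le> ept_from G S"
proof -
  define \<Psi> where "\<Psi> B = (\<Sum>i<L. stage i B) / 2" for B
  \<comment> \<open>The value 0 makes the drift condition trivial at sets that are not rooted; a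
    rooted set only leads to rooted sets.\<close>
  define \<Phi> where "\<Phi> B = (if rooted B then ennreal (\<Psi> B) else 0)" for B
  have \<Psi>_nonneg: "\<Psi> B \<ge> 0" for B
    unfolding \<Psi>_def by (intro divide_nonneg_pos sum_nonneg) (auto simp: stage_nonneg)
  have int: "integrable (measure_pmf (pzf_step G B)) f" for f :: "'a set \<Rightarrow> real" and B
    by (intro integrable_measure_pmf_finite finite_set_pzf_step pair_finite_arcs)
  have "\<Phi> S \<le> ept_from G S"
  proof (rule ept_from_ge_potential)
    show "pair_wf_digraph G" by unfold_locales
    show "ennreal ((\<Sum>i<L. ln (deg i) + 1) / 2) < \<infinity>" by simp
  next
    fix B
    show "\<Phi> B \<le> ennreal ((\<Sum>i<L. ln (deg i) + 1) / 2) * indicator (- {pverts G}) B"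
    proof (cases "B = pverts G")
      case True
      have "stage i B = 0" if "i < L" for i
        using in_arcsD2[OF arc_v_Suc[OF that]] True by (simp add: stage_def)
      then have "\<Psi> B = 0" by (simp add: \<Psi>_def)
      then show ?thesis by (simp add: \<Phi>_def)
    next
      case False
      have "\<Psi> B \<le> (\<Sum>i<L. ln (deg i) + 1) / 2"
        unfolding \<Psi>_def by (intro divide_right_mono sum_mono stage_le) auto
      then show ?thesis using False by (simp add: \<Phi>_def ennreal_leI)
    qed
  next
    fix B
    show "\<Phi> B \<le> 1 + (\<integral>\<^sup>+B'. \<Phi> B' \<partial>pzf_step G B)"
    proof (cases "rooted B")
      case True
      let ?E = "measure_pmf.expectation (pzf_step G B)"
      let ?a = "\<lambda>i. v i \<in> B \<and> v (Suc i) \<notin> B"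
      \<comment> \<open>If \<open>i < j\<close> were both active, the blue \<open>v j\<close> would
        force \<open>v (Suc i)\<close> to be blue.\<close>
      have active_unique: "\<not> i < j" if "i < L" "j < L" "?a i" "?a j" for i j
        using rooted_v_down[OF True, of j "Suc i"] that by auto
      have "card {i. i < L \<and> ?a i} \<le> 1"
        using active_unique
        by (simp add: card_le_Suc0_iff_eq) (metis linorder_neqE_nat)
      then have active: "(\<Sum>i<L. if ?a i then 2 else 0 :: real) \<le> 2"
        by (simp add: sum.If_cases Int_def)
      have "stage i B \<le> (if ?a i then 2 else 0) + ?E (stage i)" if "i < L" for i
      proof (cases "?a i")
        case True
        then show ?thesis using stage_drift_active[OF \<open>rooted B\<close> that] by simp
      next
        case False
        have "?E (stage i) = ?E (\<lambda>_. stage i B)"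
          using stage_drift_inactive[OF True _ that] False
          by (intro integral_cong_AE) (auto simp: AE_measure_pmf_iff)
        then show ?thesis using False by simp
      qed
      then have "(\<Sum>i<L. stage i B) \<le> (\<Sum>i<L. (if ?a i then 2 else 0) + ?E (stage i))"
        by (intro sum_mono) auto
      also have "\<dots> = (\<Sum>i<L. if ?a i then 2 else 0) + (\<Sum>i<L. ?E (stage i))"
        by (rule sum.distrib)
      also have "\<dots> \<le> 2 + (\<Sum>i<L. ?E (stage i))"
        using active by simp
      also have "(\<Sum>i<L. ?E (stage i)) = 2 * ?E \<Psi>"
        by (simp add: \<Psi>_def[abs_def] int)
      finally have "\<Psi> B \<le> 1 + ?E \<Psi>" by (simp add: \<Psi>_def)
      then have "ennreal (\<Psi> B) \<le> 1 + ennreal (?E \<Psi>)"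
        by (metis ennreal_1 ennreal_leI ennreal_plus integral_nonneg_AE AE_I2 \<Psi>_nonneg zero_le_one)
      also have "ennreal (?E \<Psi>) = (\<integral>\<^sup>+B'. ennreal (\<Psi> B') \<partial>pzf_step G B)"
        by (intro nn_integral_eq_integral[symmetric] int) (simp add: \<Psi>_nonneg)
      also have "\<dots> = (\<integral>\<^sup>+B'. \<Phi> B' \<partial>pzf_step G B)"
        using rooted_step[OF True]
        by (intro nn_integral_cong_AE) (auto simp: AE_measure_pmf_iff \<Phi>_def)
      finally show ?thesis using True by (simp add: \<Phi>_def)
    qed (simp add: \<Phi>_def)
  qed
  moreover have "\<Phi> S = ennreal ((\<Sum>i<L. ln (deg i / 2) + 1) / 2)"
  proof -
    have "rooted S" "i \<le> L \<Longrightarrow> v i \<notin> S" for i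
      using assms v_in_A[of i] by (auto simp: rooted_def)
    then show ?thesis by (simp add: \<Phi>_def \<Psi>_def stage_def)
  qed
  ultimately show ?thesis by simp
qed

end

section \<open>Distances via walks and Lipschitz functions\<close>

lemma (in pair_wf_digraph) awalk_of_relpow:
  assumes "(u, w) \<in> parcs G ^^ k" "u \<in> pverts G"
  shows "\<exists>p. awalk u p w \<and> length p = k"
  using assms
proof (induction k arbitrary: w)
  case 0
  then show ?case by (auto simp: awalk_Nil_iff)
next
  case (Suc k)
  then obtain y where y: "(u, y) \<in> parcs G ^^ k" "(y, w) \<in> parcs G" by auto
  with Suc obtain p where p: "awalk u p y" "length p = k" by auto
  have "awalk y [(y, w)] w" using y(2) in_arcsD1 in_arcsD2 by (auto simp: awalk_simps)
  with p show ?case by (intro exI[of _ "p @ [(y, w)]"]) (auto intro: awalk_appendI)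
qed

lemma (in pair_wf_digraph) mu_le_of_relpow:
  assumes "(u, w) \<in> parcs G ^^ k" "u \<in> pverts G"
  shows "\<mu> (\<lambda>_. 1) u w \<le> ereal (real k)"
proof -
  obtain p where p: "awalk u p w" "length p = k" using awalk_of_relpow[OF assms] by auto
  have "awalk_cost (\<lambda>_. 1) p = real (length p)" by (induction p) auto
  with min_cost_le_walk_cost[OF p(1), of "\<lambda>_. 1"] p(2) show ?thesis by simp
qed

text \<open>Along a walk \<open>f\<close> rises by at most 1 per arc, so every walk from
  \<open>u\<close> to \<open>w\<close> costs at least \<open>f w - f u\<close>.\<close>

lemma (in pair_wf_digraph) mu_ge_of_lipschitz:
  fixes f :: "'a \<Rightarrow> real"
  assumes "\<And>x y. (x, y) \<in> parcs G \<Longrightarrow> f y \<le> f x + 1"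
  shows "ereal (f w - f u) \<le> \<mu> (\<lambda>_. 1) u w"
  unfolding \<mu>_def
proof (rule INF_greatest)
  fix p assume "p \<in> {p. awalk u p w}"
  then have "f w - f u \<le> awalk_cost (\<lambda>_. 1) p"
    unfolding mem_Collect_eq
  proof (induction p arbitrary: u)
    case (Cons e p)
    then have "f (snd e) \<le> f u + 1" "f w - f (snd e) \<le> awalk_cost (\<lambda>_. 1) p"
      using assms[of u "snd e"] by (auto simp: awalk_Cons_iff)
    then show ?case by simp
  qed (simp add: awalk_Nil_iff)
  then show "ereal (f w - f u) \<le> ereal (awalk_cost (\<lambda>_. 1) p)" by simp
qed

lemma (in pair_sym_digraph) connected_of_center:
  assumes "c \<in> pverts G" "\<And>x. x \<in> pverts G \<Longrightarrow> (c, x) \<in> (parcs G)\<^sup>*"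
  shows "Digraph_Component.connected (with_proj G)"
proof -
  have reach: "c \<rightarrow>\<^sup>*\<^bsub>with_proj G\<^esub> x" if x: "x \<in> pverts G" for x
  proof -
    obtain k where "(c, x) \<in> parcs G ^^ k" using assms(2)[OF x] rtrancl_imp_relpow by blast
    then show ?thesis using awalk_of_relpow[OF _ assms(1)] reachable_awalk by blast
  qed
  have "x \<rightarrow>\<^sup>*\<^bsub>with_proj G\<^esub> y" if "x \<in> pverts G" "y \<in> pverts G" for x y
    using reach[OF that(1)] reach[OF that(2)] symmetric_reachable' reachable_trans by blast
  \<comment> \<open>\<open>connected\<close> means strong connectedness of the symmetric closure,
    hence the passage to \<open>mk_symmetric\<close>.\<close>
  then have "x \<rightarrow>\<^sup>*\<^bsub>with_proj (mk_symmetric G)\<^esub> y" if "x \<in> pverts G" "y \<in> pverts G" for x y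
    using that reachable_mk_symmetricI by blast
  then show ?thesis
    unfolding connected_def using assms(1) by (intro strongly_connectedI) auto
qed

section \<open>The caterpillar\<close>

text \<open>Vertices below 2s+4 form the spine.  The others are leaves, attached to the spine
  vertices 2, ..., 2s+1 in a round-robin fashion.\<close>

definition block :: "nat \<Rightarrow> nat \<Rightarrow> nat" where
  "block s x = (if x < 2 * s + 4 then x else 2 + (x - (2 * s + 4)) mod (2 * s))"

definition child :: "nat \<Rightarrow> nat \<Rightarrow> nat \<Rightarrow> bool" where
  "child s x y \<longleftrightarrow> (if y < 2 * s + 4 then y = Suc x else x = block s y)"

definition caterpillar :: "nat \<Rightarrow> nat \<Rightarrow> nat pair_pre_digraph" where
  "caterpillar s n = \<lparr>pverts = {..<n},
     parcs = {(x, y). x < n \<and> y < n \<and> (child s x y \<or> child s y x)}\<rparr>"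

lemma block_spine [simp]: "x < 2 * s + 4 \<Longrightarrow> block s x = x"
  by (simp add: block_def)

lemma block_leaf:
  assumes "s > 0" "\<not> x < 2 * s + 4"
  shows "2 \<le> block s x" "block s x \<le> 2 * s + 1"
  using assms by (auto simp: block_def Suc_le_eq)

lemma child_less:
  assumes "s > 0" "child s x y"
  shows "x < y" "x < 2 * s + 4"
  using assms block_leaf[of s y] by (auto simp: child_def split: if_splits)

text \<open>A leaf shares the \<open>block\<close> value of its support vertex. Thus
  \<open>block\<close> and its negative are Lipschitz along arcs and bound distances from
  below.\<close>

lemma block_child:
  assumes "s > 0" "child s x y"
  shows "block s x \<le> block s y" "block s y \<le> Suc (block s x)"
  using assms block_leaf[of s y] by (auto simp: child_def split: if_splits)

lemma caterpillar_simps: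
  "pverts (caterpillar s n) = {..<n}"
  "(x, y) \<in> parcs (caterpillar s n) \<longleftrightarrow> x < n \<and> y < n \<and> (child s x y \<or> child s y x)"
  by (auto simp: caterpillar_def)

lemma pair_graph_caterpillar:
  assumes "s > 0"
  shows "pair_graph (caterpillar s n)"
proof
  show "finite (parcs (caterpillar s n))"
    by (rule finite_subset[of _ "{..<n} \<times> {..<n}"]) (auto simp: caterpillar_def)
  show "fst e \<noteq> snd e" if "e \<in> parcs (caterpillar s n)" for e
    using that child_less[OF assms] by (fastforce simp: caterpillar_def)
  show "symmetric (with_proj (caterpillar s n))"
    by (auto simp: symmetric_def sym_def caterpillar_simps)
qed (auto simp: caterpillar_def)

section \<open>Radius, degrees and expected time of the caterpillar\<close>

context
  fixes s m n :: nat
  assumes s: "s > 0" and m: "m \<ge> 2" and n: "n = (2 * s + 1) * m"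
begin

interpretation G: pair_graph "caterpillar s n"
  by (rule pair_graph_caterpillar[OF s])

lemma spine_less_n: "x < 2 * s + 4 \<Longrightarrow> x < n"
proof -
  have "(2 * s + 1) * 2 \<le> n" unfolding n using m by (intro mult_le_mono2)
  moreover assume "x < 2 * s + 4"
  ultimately show ?thesis using s by simp
qed

lemma spine_relpow:
  assumes "x + k < 2 * s + 4"
  shows "(x, x + k) \<in> parcs (caterpillar s n) ^^ k \<and> (x + k, x) \<in> parcs (caterpillar s n) ^^ k"
  using assms
proof (induction k)
  case (Suc k)
  have "(x + k, x + Suc k) \<in> parcs (caterpillar s n)" "(x + Suc k, x + k) \<in> parcs (caterpillar s n)"
    using Suc.prems spine_less_n[of "x + k"] spine_less_n[of "x + Suc k"]
    by (auto simp: caterpillar_simps child_def)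
  moreover have "(x, x + k) \<in> parcs (caterpillar s n) ^^ k" "(x + k, x) \<in> parcs (caterpillar s n) ^^ k"
    using Suc by auto
  ultimately show ?case
    by (blast intro: relpow_Suc_I relpow_Suc_I2)
qed auto

lemma center_relpow:
  assumes "x < n"
  obtains k where "k \<le> s + 2" "(s + 1, x) \<in> parcs (caterpillar s n) ^^ k"
proof -
  \<comment> \<open>The sharper bound \<open>s\<close> at the vertices that carry leaves leaves room
    for one more edge to a leaf.\<close>
  have spine: "\<exists>k. (s + 1, y) \<in> parcs (caterpillar s n) ^^ k \<and> k \<le> s + 2 \<and>
      (2 \<le> y \<longrightarrow> y \<le> 2 * s + 1 \<longrightarrow> k \<le> s)" if "y < 2 * s + 4" for y
  proof (cases "s + 1 \<le> y")
    case True
    then show ?thesis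
      using spine_relpow[of "s + 1" "y - (s + 1)"] that by (intro exI[of _ "y - (s + 1)"]) auto
  next
    case False
    then show ?thesis
      using spine_relpow[of y "s + 1 - y"] that by (intro exI[of _ "s + 1 - y"]) auto
  qed
  show ?thesis
  proof (cases "x < 2 * s + 4")
    case True
    then show ?thesis using spine that by blast
  next
    case False
    note b = block_leaf[OF s False]
    then obtain k where k: "(s + 1, block s x) \<in> parcs (caterpillar s n) ^^ k" "k \<le> s"
      using spine[of "block s x"] by auto
    have "(block s x, x) \<in> parcs (caterpillar s n)"
      using assms False b spine_less_n[of "block s x"] by (auto simp: caterpillar_simps child_def)
    with k show ?thesis by (intro that[of "Suc k"]) auto
  qed
qed

lemma connected_caterpillar: "Digraph_Component.connected (with_proj (caterpillar s n))"
proof (rule G.connected_of_center)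
  show "s + 1 \<in> pverts (caterpillar s n)" using spine_less_n[of "s + 1"] by (simp add: caterpillar_simps)
  fix x assume "x \<in> pverts (caterpillar s n)"
  then have "x < n" by (simp add: caterpillar_simps)
  then obtain k where "(s + 1, x) \<in> parcs (caterpillar s n) ^^ k" by (rule center_relpow)
  then show "(s + 1, x) \<in> (parcs (caterpillar s n))\<^sup>*" by (rule relpow_imp_rtrancl)
qed

text \<open>The upper bound comes from the centre \<open>s + 1\<close>. For the lower bound, a
  vertex with \<open>block\<close> value at most \<open>s + 1\<close> is far from the end
  \<open>2 * s + 3\<close>, and any other vertex is far from the end \<open>0\<close>.\<close>

lemma radius_caterpillar: "radius (caterpillar s n) = ereal (real (s + 2))"
proof (rule antisym)
  have c: "s + 1 \<in> pverts (caterpillar s n)"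
    using spine_less_n[of "s + 1"] by (simp add: caterpillar_simps)
  have "G.\<mu> (\<lambda>_. 1) (s + 1) x \<le> ereal (real (s + 2))" if x: "x < n" for x
  proof -
    obtain k where k: "k \<le> s + 2" "(s + 1, x) \<in> parcs (caterpillar s n) ^^ k"
      using center_relpow[OF x] by blast
    from k(1) have "ereal (real k) \<le> ereal (real (s + 2))" by simp
    with G.mu_le_of_relpow[OF k(2) c] show ?thesis by (rule order_trans)
  qed
  then have "eccentricity (caterpillar s n) (s + 1) \<le> ereal (real (s + 2))"
    unfolding eccentricity_def by (intro SUP_least) (simp add: caterpillar_simps)
  with c show "radius (caterpillar s n) \<le> ereal (real (s + 2))"
    unfolding radius_def by (rule INF_lower2)
next
  show "ereal (real (s + 2)) \<le> radius (caterpillar s n)"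
    unfolding radius_def
  proof (rule INF_greatest)
    fix x assume "x \<in> pverts (caterpillar s n)"
    have lip: "real (block s y) \<le> real (block s x) + 1 \<and> - real (block s y) \<le> - real (block s x) + 1"
      if "(x, y) \<in> parcs (caterpillar s n)" for x y
      using that block_child[OF s, of x y] block_child[OF s, of y x] by (auto simp: caterpillar_simps)
    show "ereal (real (s + 2)) \<le> eccentricity (caterpillar s n) x"
    proof (cases "block s x \<le> s + 1")
      case True
      have "ereal (real (s + 2)) \<le> ereal (real (block s (2 * s + 3)) - real (block s x))"
        using True by simp
      also have "\<dots> \<le> G.\<mu> (\<lambda>_. 1) x (2 * s + 3)"
        using lip by (intro G.mu_ge_of_lipschitz[of "\<lambda>x. real (block s x)"]) blast
      also have "\<dots> \<le> eccentricity (caterpillar s n) x"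
        unfolding eccentricity_def
        using spine_less_n[of "2 * s + 3"] by (intro SUP_upper) (simp add: caterpillar_simps)
      finally show ?thesis .
    next
      case False
      have "ereal (real (s + 2)) \<le> ereal (- real (block s 0) - - real (block s x))"
        using False by simp
      also have "\<dots> \<le> G.\<mu> (\<lambda>_. 1) x 0"
        using lip by (intro G.mu_ge_of_lipschitz[of "\<lambda>x. - real (block s x)"]) blast
      also have "\<dots> \<le> eccentricity (caterpillar s n) x"
        unfolding eccentricity_def
        using spine_less_n[of 0] by (intro SUP_upper) (simp add: caterpillar_simps)
      finally show ?thesis .
    qed
  qed
qed

lemma spine_degree:
  assumes b: "2 \<le> b" "b \<le> 2 * s + 1"
  shows "m \<le> out_degree (with_proj (caterpillar s n)) b"
proof -
  \<comment> \<open>The leaves of \<open>b\<close> are the numbers from \<open>2 * s + 4\<close> on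
    whose offset is \<open>b - 2\<close> modulo \<open>2 * s\<close>. The first \<open>m - 2\<close>
    of them lie below \<open>n\<close>; with the two spine neighbours they give degree
    \<open>m\<close>.\<close>
  define f where "f t = 2 * s + 4 + (b - 2) + 2 * s * t" for t
  have f: "(b, f t) \<in> parcs (caterpillar s n)" if "t < m - 2" for t
  proof -
    have "2 * s * (t + 3) \<le> 2 * s * m" using that by (intro mult_le_mono2) simp
    then have "f t < n" using b s that by (simp add: f_def n algebra_simps)
    moreover have "block s (f t) = b"
    proof -
      have "f t - (2 * s + 4) = (b - 2) + 2 * s * t" by (simp add: f_def)
      then have "(f t - (2 * s + 4)) mod (2 * s) = b - 2"
        using b s by (simp only: mod_mult_self2) simp
      then show ?thesis using b by (simp add: block_def f_def)
    qed
    ultimately show ?thesis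
      using b spine_less_n[of b] by (simp add: caterpillar_simps child_def f_def)
  qed
  have "card ({b - 1, b + 1} \<union> f ` {..<m - 2}) \<le> card {w. (b, w) \<in> parcs (caterpillar s n)}"
  proof (rule card_mono)
    show "finite {w. (b, w) \<in> parcs (caterpillar s n)}"
      by (rule finite_subset[of _ "{..<n}"]) (auto simp: caterpillar_simps)
    show "{b - 1, b + 1} \<union> f ` {..<m - 2} \<subseteq> {w. (b, w) \<in> parcs (caterpillar s n)}"
    proof -
      have "(b, b - 1) \<in> parcs (caterpillar s n)" "(b, b + 1) \<in> parcs (caterpillar s n)"
        using b spine_less_n[of b] spine_less_n[of "b - 1"] spine_less_n[of "b + 1"]
        by (auto simp: caterpillar_simps child_def)
      with f show ?thesis by auto
    qed
  qed
  moreover have "card ({b - 1, b + 1} \<union> f ` {..<m - 2}) = card {b - 1, b + 1} + card (f ` {..<m - 2})"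
    using b by (intro card_Un_disjoint) (auto simp: f_def)
  moreover have "card (f ` {..<m - 2}) = m - 2"
    using s by (subst card_image) (auto simp: f_def inj_on_def)
  ultimately show ?thesis
    using m by (simp add: out_degree_eq_card)
qed

text \<open>The start lies in one half of the caterpillar, so the other half is an arm that misses
  it and has \<open>s\<close> vertices of degree at least \<open>m\<close> to cross.\<close>

lemma ept_caterpillar_ge: "ennreal (real s * (ln (real m / 2) + 1) / 2) \<le> ept (caterpillar s n)"
  unfolding ept_def
proof (rule INF_greatest)
  fix x assume "x \<in> pverts (caterpillar s n)"
  have bound: "ennreal (real s * (ln (real m / 2) + 1) / 2) \<le> ept_from (caterpillar s n) {x}"
    if arm: "pzf_arm (caterpillar s n) A pa v s" and x: "x \<notin> A"
      and v: "\<And>i. i < s \<Longrightarrow> 2 \<le> v i \<and> v i \<le> 2 * s + 1" for A pa v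
  proof -
    interpret pzf_arm "caterpillar s n" A pa v s by (rule arm)
    have "ln (real m / 2) \<le> ln (deg i / 2)" if "i < s" for i
      using spine_degree[of "v i"] v[OF that] m by (simp add: deg_def)
    then have "(\<Sum>i<s. ln (real m / 2) + 1) \<le> (\<Sum>i<s. ln (deg i / 2) + 1)"
      by (intro sum_mono add_right_mono) auto
    then have "real s * (ln (real m / 2) + 1) / 2 \<le> (\<Sum>i<s. ln (deg i / 2) + 1) / 2"
      by simp
    then have "ennreal (real s * (ln (real m / 2) + 1) / 2) \<le>
        ennreal ((\<Sum>i<s. ln (deg i / 2) + 1) / 2)"
      by (rule ennreal_leI)
    also have "\<dots> \<le> ept_from (caterpillar s n) {x}"
      using x by (intro ept_from_ge_arm) simp
    finally show ?thesis .
  qed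
  show "ennreal (real s * (ln (real m / 2) + 1) / 2) \<le> ept_from (caterpillar s n) {x}"
  proof (cases "block s x \<le> s + 1")
    case True
    \<comment> \<open>The right half, entered from \<open>s + 1\<close>. The front runs over
      \<open>s + 2\<close>, ..., \<open>2 * s + 1\<close>, all carrying stages;
      \<open>v s = 2 * s + 2\<close> only marks the end.\<close>
    have arm: "pzf_arm (caterpillar s n) {x. s + 2 \<le> block s x}
      (\<lambda>x. if x < 2 * s + 4 then x - 1 else block s x) (\<lambda>i. s + 2 + i) s"
    proof (intro pzf_arm.intro pzf_arm_axioms.intro pair_graph_caterpillar s, goal_cases)
      case (1 x y)
      then have "child s x y \<or> child s y x" by (simp add: caterpillar_simps)
      then show ?case
      proof
        assume xy: "child s x y"
        with 1 child_less[OF s xy] show ?case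
          by (cases "y < 2 * s + 4") (auto simp: child_def)
      next
        assume "child s y x"
        then show ?case by (cases "x < 2 * s + 4") (auto simp: child_def)
      qed
    next
      case (4 i)
      then show ?case
        using spine_less_n[of "s + 2 + i"] spine_less_n[of "s + 1 + i"]
        by (simp add: caterpillar_simps child_def)
    qed simp_all
    show ?thesis by (rule bound[OF arm]) (use True in auto)
  next
    case False
    \<comment> \<open>The mirror image: the left half is entered from \<open>s + 2\<close> and
      traversed from \<open>s + 1\<close> down to \<open>2\<close>, with \<open>v s = 1\<close> as
      end marker.\<close>
    have arm: "pzf_arm (caterpillar s n) {x. block s x \<le> s + 1}
      (\<lambda>x. if x < 2 * s + 4 then Suc x else block s x) (\<lambda>i. s + 1 - i) s"
    proof (intro pzf_arm.intro pzf_arm_axioms.intro pair_graph_caterpillar s, goal_cases)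
      case (1 x y)
      then have "child s x y \<or> child s y x" by (simp add: caterpillar_simps)
      then show ?case
      proof
        assume xy: "child s x y"
        with 1 child_less[OF s xy] show ?case
          by (cases "y < 2 * s + 4") (auto simp: child_def)
      next
        assume yx: "child s y x"
        with 1 child_less[OF s yx] show ?case
          by (cases "x < 2 * s + 4") (auto simp: child_def)
      qed
    next
      case (4 i)
      then show ?case
        using spine_less_n[of "s + 1 - i"] spine_less_n[of "Suc (s + 1 - i)"]
        by (simp add: caterpillar_simps child_def)
    qed auto
    show ?thesis by (rule bound[OF arm]) (use False in auto)
  qed
qed

end

text \<open>The case \<open>n = 2 * s + 1\<close> has to be excluded: a connected graph of radius
  \<open>r\<close> has at least \<open>2 * r\<close> vertices, here
  \<open>2 * s + 4\<close>.\<close>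

theorem theorem3p6:
  shows "\<exists>c::real. c > 0 \<and>
    (\<forall>s n :: nat. s > 0 \<longrightarrow> n > 0 \<longrightarrow> (2 * s + 1) dvd n \<longrightarrow> n \<noteq> 2 * s + 1 \<longrightarrow>
      (\<exists>G :: nat pair_pre_digraph.
         pair_graph G \<and> Digraph_Component.connected (with_proj G) \<and>
         card (pverts G) = n \<and> radius G = ereal (real (s + 2)) \<and>
         ept G \<ge> ennreal (c * real (s + 2) * ln (real n / real (s + 2)))))"
\<comment> \<open>12 is 3 * 2 * 2: \<open>s + 2\<close> is at most \<open>3 * s\<close>, the
  logarithm is at most twice \<open>ln (m / 2) + 1\<close>, and \<open>ept_caterpillar_ge\<close>
  contributes the last factor 2.\<close>
proof (intro exI[of _ "1 / 12"] conjI allI impI)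
  fix s n :: nat
  assume s: "s > 0" and "n > 0" "(2 * s + 1) dvd n" "n \<noteq> 2 * s + 1"
  then obtain m where n: "n = (2 * s + 1) * m" by (elim dvdE)
  with \<open>n > 0\<close> \<open>n \<noteq> 2 * s + 1\<close> have m: "m \<ge> 2"
    by (cases m; cases "m - 1") auto
  let ?Y = "ln (real m / 2) + 1"
  have "real n / real (s + 2) \<le> 2 * real m"
    by (simp add: n field_simps)
  moreover have "real n > 0" using \<open>n > 0\<close> by simp
  ultimately have "ln (real n / real (s + 2)) \<le> ln (2 * real m)"
    by (intro ln_mono) auto
  also have "\<dots> = ln (real m / 2) + 2 * ln 2"
    using m by (simp add: ln_mult ln_div)
  also have "\<dots> \<le> 2 * ?Y"
  proof -
    have "0 \<le> ln (real m / 2)" using m by (intro ln_ge_zero) simp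
    then show ?thesis using ln_le_minus_one[of "2 :: real"] by simp
  qed
  finally have "1 / 12 * real (s + 2) * ln (real n / real (s + 2)) \<le> 1 / 12 * real (s + 2) * (2 * ?Y)"
    by (intro mult_left_mono) auto
  also have "\<dots> \<le> 1 / 12 * (3 * real s) * (2 * ?Y)"
    using s m by (intro mult_right_mono mult_left_mono) auto
  also have "\<dots> = real s * ?Y / 2"
    by simp
  finally have "ennreal (1 / 12 * real (s + 2) * ln (real n / real (s + 2))) \<le>
      ennreal (real s * ?Y / 2)"
    by (rule ennreal_leI)
  also have "\<dots> \<le> ept (caterpillar s n)"
    by (rule ept_caterpillar_ge[OF s m n])
  finally have "ennreal (1 / 12 * real (s + 2) * ln (real n / real (s + 2))) \<le> ept (caterpillar s n)" .
  then show "\<exists>G :: nat pair_pre_digraph.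
      pair_graph G \<and> Digraph_Component.connected (with_proj G) \<and>
      card (pverts G) = n \<and> radius G = ereal (real (s + 2)) \<and>
      ept G \<ge> ennreal (1 / 12 * real (s + 2) * ln (real n / real (s + 2)))"
    using pair_graph_caterpillar[OF s] connected_caterpillar[OF s m n] radius_caterpillar[OF s m n]
    by (intro exI[of _ "caterpillar s n"]) (simp add: caterpillar_simps)
qed simp

end
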